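(* Let $[l^{(1)}]\langle r^{(2)}\rangle[l^{(3)}]\langle r^{(4)}\rangle\cdots$ be a path in $\Gamma(\Omega,q)$ with $[l^{(1)}]=[0]_{x_1}$, and let $\boldsymbol{s}=(s_1,s_2,\ldots)$ be a sequence of nonnegative integers. Then, for positive integers $i,j$ with $1\le j\le i$ (such that the vertices concerned lie on the path), $$r^{(2i)}_{\sigma_{2j-1}(\boldsymbol{s})}=\sum_{1\le a_1\le a_2<a_3\le a_4<\cdots<a_{2j-1}\le i}\Phi_{\boldsymbol{s}}(a_1,a_2,\ldots,a_{2j-1}),\quad\text{if }\sigma_{2j-1}(\boldsymbol{s})\in\Omega,$$ $$l^{(2i+1)}_{\sigma_{2j}(\boldsymbol{s})}=\sum_{1\le a_1\le a_2<a_3\le a_4<\cdots<a_{2j-1}\le a_{2j}\le i}\Phi_{\boldsymbol{s}}(a_1,a_2,\ldots,a_{2j}),\quad\text{if }\sigma_{2j}(\boldsymbol{s})\in\Omega.$$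
   Context: Let $q$ be a prime power and $\mathbb{F}_q$ the field with $q$ elements; $x^0=1$ for every $x\in\mathbb{F}_q$. $\{0,1\}^*$ is the set of finite binary sequences, $\eta$ the null sequence; juxtaposition is concatenation; $\alpha^i$ is the $i$-fold concatenation of $\alpha$ ($\alpha^0=\eta$). $\Omega\subset\{0,1\}^*$ is a finite set satisfying condition C1: $\eta\in\Omega$, and for any $\alpha\in\Omega\setminus\{\eta\}$ the sequence obtained by deleting the last bit of $\alpha$ is in $\Omega$. $L(\Omega)$ and $R(\Omega)$ are two disjoint copies of $\mathbb{F}_q^{|\Omega|+1}$; their vectors are written $[l]$ and $\langle r\rangle$ respectively, with entries indexed by $\Omega\cup\{*\}$, where $*\notin\Omega$ is an extra symbol; the entry at $*$ is called the color. $[0]_x\in L(\Omega)$ is the vector with color $x$ and all other entries $0$. $\Gamma(\Omega,q)$ is the bipartite graph with vertex set $L(\Omega)\cup R(\Omega)$ in which $[l]\in L(\Omega)$ and $\langle r\rangle\in R(\Omega)$ are adjacent if and only if $l_\eta+r_\eta=l_*r_*$, $l_{\alpha0}+r_{\alpha0}=r_*l_\alpha$ for all $\alpha0\in\Omega$, and $l_{\beta1}+r_{\beta1}=l_*r_\beta$ for all $\beta1\in\Omega$ (here $\alpha,\beta\in\{0,1\}^*$). By convention $*0=*1=\eta$. A path is a sequence of vertices in which consecutive vertices are adjacent and the two neighbors of each vertex in the sequence are different (so $[l^{(2j-1)}]\ne[l^{(2j+1)}]$ and $\langle r^{(2j)}\rangle\neq\langle r^{(2j+2)}\rangle$); vertices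 may repeat. Write $x_i=l^{(i)}_*$ for $i$ odd, $x_i=r^{(i)}_*$ for $i$ even, $i\ge1$, and put $x_0=0$. $\sigma_1(\boldsymbol{s})=1^{s_1-1}$ if $s_1>0$ and $\sigma_1(\boldsymbol{s})=*$ if $s_1=0$; for $i\ge2$, $\sigma_i(\boldsymbol{s})=\sigma_{i-1}(\boldsymbol{s})10^{s_i}$ if $i$ is even and $\sigma_i(\boldsymbol{s})=\sigma_{i-1}(\boldsymbol{s})01^{s_i}$ if $i$ is odd. For positive integers $a_1\le a_2<a_3\le a_4<\cdots$, define $\Phi_{\boldsymbol{s}}(a_1)=(x_{2a_1}-x_{2a_1-2})x_{2a_1-1}^{s_1}$ and, for $n\ge2$, $\Phi_{\boldsymbol{s}}(a_1,\ldots,a_n)=\Phi_{\boldsymbol{s}}(a_1,\ldots,a_{n-1})(x_{2a_n+1}-x_{2a_n-1})x_{2a_n}^{s_n}$ if $n$ is even, and $\Phi_{\boldsymbol{s}}(a_1,\ldots,a_n)=\Phi_{\boldsymbol{s}}(a_1,\ldots,a_{n-1})(x_{2a_n}-x_{2a_n-2})x_{2a_n-1}^{s_n}$ if $n$ is odd. *)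

theory Defs
  imports Complex_Main "HOL-Library.FuncSet" "HOL-Library.Extended_Nat"
begin

(* Binary sequences are lists of bits, with False for 0 and True for 1; the last bit of the
   sequence is the last element of the list. *)

type_synonym word = "bool list"

definition C1 :: "word set \<Rightarrow> bool" where
  "C1 \<Omega> \<longleftrightarrow> [] \<in> \<Omega> \<and> (\<forall>\<alpha>\<in>\<Omega> - {[]}. butlast \<alpha> \<in> \<Omega>)"

(* Star is the extra symbol *, the index of the color. *)
datatype idx = Star | Word word

(* Right concatenation, with the convention *0 = *1 = (null sequence). *)
fun app :: "idx \<Rightarrow> word \<Rightarrow> idx" where
  "app Star [] = Star"
| "app Star (b # w) = Word w"
| "app (Word \<alpha>) w = Word (\<alpha> @ w)"

definition idxs :: "word set \<Rightarrow> idx set" where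
  "idxs \<Omega> = insert Star (Word ` \<Omega>)"

(* Functions that are undefined outside the index set, so that HOL equality of two such
   vectors is equality of all their entries. *)
definition vecs :: "word set \<Rightarrow> (idx \<Rightarrow> 'a) set" where
  "vecs \<Omega> = (idxs \<Omega> \<rightarrow>\<^sub>E UNIV)"

definition zero_vec :: "word set \<Rightarrow> 'a::zero \<Rightarrow> (idx \<Rightarrow> 'a)" where
  "zero_vec \<Omega> x = (\<lambda>k\<in>idxs \<Omega>. if k = Star then x else 0)"

datatype 'a vertex = LV "idx \<Rightarrow> 'a" | RV "idx \<Rightarrow> 'a"

definition verts :: "word set \<Rightarrow> 'a vertex set" where
  "verts \<Omega> = LV ` vecs \<Omega> \<union> RV ` vecs \<Omega>"

definition adj_eqs :: "word set \<Rightarrow> (idx \<Rightarrow> 'a::field) \<Rightarrow> (idx \<Rightarrow> 'a) \<Rightarrow> bool" where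
  "adj_eqs \<Omega> l r \<longleftrightarrow>
     l (Word []) + r (Word []) = l Star * r Star \<and>
     (\<forall>\<alpha>. \<alpha> @ [False] \<in> \<Omega> \<longrightarrow>
        l (Word (\<alpha> @ [False])) + r (Word (\<alpha> @ [False])) = r Star * l (Word \<alpha>)) \<and>
     (\<forall>\<beta>. \<beta> @ [True] \<in> \<Omega> \<longrightarrow>
        l (Word (\<beta> @ [True])) + r (Word (\<beta> @ [True])) = l Star * r (Word \<beta>))"

fun adj :: "word set \<Rightarrow> 'a::field vertex \<Rightarrow> 'a vertex \<Rightarrow> bool" where
  "adj \<Omega> (LV l) (RV r) = adj_eqs \<Omega> l r"
| "adj \<Omega> (RV r) (LV l) = adj_eqs \<Omega> l r"
| "adj \<Omega> (LV _) (LV _) = False"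
| "adj \<Omega> (RV _) (RV _) = False"

(* The sequence v 1, v 2, ..., v N, which is infinite if N is infinity. *)
definition is_path :: "word set \<Rightarrow> enat \<Rightarrow> (nat \<Rightarrow> 'a::field vertex) \<Rightarrow> bool" where
  "is_path \<Omega> N v \<longleftrightarrow>
     (\<forall>k\<ge>1. enat k \<le> N \<longrightarrow> v k \<in> verts \<Omega>) \<and>
     (\<forall>k\<ge>1. enat (k + 1) \<le> N \<longrightarrow> adj \<Omega> (v k) (v (k + 1))) \<and>
     (\<forall>k\<ge>1. enat (k + 2) \<le> N \<longrightarrow> v k \<noteq> v (k + 2))"

definition colors :: "(nat \<Rightarrow> idx \<Rightarrow> 'a::zero) \<Rightarrow> (nat \<Rightarrow> idx \<Rightarrow> 'a) \<Rightarrow> nat \<Rightarrow> 'a" where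
  "colors l r k = (if k = 0 then 0 else if odd k then l k Star else r k Star)"

(* The sequence s is indexed from 1; the value of sigma s at 0 is a dummy. *)
fun sigma :: "(nat \<Rightarrow> nat) \<Rightarrow> nat \<Rightarrow> idx" where
  "sigma s 0 = Star"
| "sigma s (Suc 0) = (if s 1 > 0 then Word (replicate (s 1 - 1) True) else Star)"
| "sigma s (Suc (Suc n)) =
     (if even n then app (sigma s (Suc n)) (True # replicate (s (Suc (Suc n))) False)
      else app (sigma s (Suc n)) (False # replicate (s (Suc (Suc n))) True))"

(* Phi x s a n is the product attached to the tuple (a 1, ..., a n).  The empty product at 0
   makes the case n = 1 an instance of the odd case. *)
fun Phi :: "(nat \<Rightarrow> 'a::field) \<Rightarrow> (nat \<Rightarrow> nat) \<Rightarrow> (nat \<Rightarrow> nat) \<Rightarrow> nat \<Rightarrow> 'a" where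
  "Phi x s a 0 = 1"
| "Phi x s a (Suc n) = Phi x s a n *
     (let k = a (Suc n) in
      if even (Suc n) then (x (2 * k + 1) - x (2 * k - 1)) * x (2 * k) ^ s (Suc n)
      else (x (2 * k) - x (2 * k - 2)) * x (2 * k - 1) ^ s (Suc n))"

(* The tuples with 1 \<le> a 1 \<le> a 2 < a 3 \<le> a 4 < ... a n \<le> i. *)
definition tuples :: "nat \<Rightarrow> nat \<Rightarrow> (nat \<Rightarrow> nat) set" where
  "tuples n i = {a \<in> {1..n} \<rightarrow>\<^sub>E {1..i}.
     \<forall>k. 1 \<le> k \<and> k < n \<longrightarrow> (if odd k then a k \<le> a (k + 1) else a k < a (k + 1))}"

end

theory Submission
  imports Defs
begin

text \<open>
  Two neighbours of the same vertex satisfy almost the same equations, so subtracting these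
  equations eliminates the entries of the common vertex, except those on the right-hand sides.
  If \<open>r\<close> and \<open>r'\<close> are adjacent to \<open>l\<close>, appending a \<open>1\<close> to an index multiplies the difference of
  the entries of \<open>r'\<close> and \<open>r\<close> by the color of \<open>l\<close>, whereas at an index \<open>p0\<close> this difference is the
  entry of \<open>l\<close> at \<open>p\<close> times the difference of the colors of \<open>r'\<close> and \<open>r\<close>; exchanging the two sides
  of the graph exchanges the two bits.  Hence, with a block \<open>0 1\<^sup>s\<close> or \<open>1 0\<^sup>s\<close> appended to
  \<open>p\<close>, the difference is one factor of \<open>Phi\<close> times the entry of the common vertex at \<open>p\<close>
  (\<open>adj_eqs_diff_R\<close>, \<open>adj_eqs_diff_L\<close>).

  Consequently the entry at \<open>sigma s (Suc n)\<close> is a telescoping sum, along the path, of factors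
  times entries at \<open>sigma s n\<close>.  The sums of \<open>Phi\<close> over \<open>tuples\<close> satisfy the same recurrence, by
  splitting the tuples according to whether their last component reaches its upper bound
  (\<open>Phi_sum_Suc\<close>).  The alternation of \<open>\<le>\<close> and \<open><\<close> between the components records which neighbour
  supplies the entry at \<open>sigma s n\<close>: the step from vertex \<open>2i\<close> to vertex \<open>2i + 2\<close> passes vertex
  \<open>2i + 1\<close>, whose entry is a sum over tuples bounded by \<open>i\<close>, and the step from vertex \<open>2i + 1\<close> to
  vertex \<open>2i + 3\<close> passes vertex \<open>2i + 2\<close>, whose entry is a sum over tuples bounded by \<open>i + 1\<close>.

  On the left side the telescoping starts at the first vertex, whose entries other than the color
  vanish.  On the right side it starts one vertex earlier: the zero vector of \<open>R(\<Omega>)\<close> is adjacent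
  to the first vertex, so it can be put in front of the path, and its color agrees with
  \<open>x\<^sub>0 = 0\<close>.
\<close>

section \<open>Indices\<close>

lemma app_append: "app (app p u) v = app p (u @ v)"
  by (cases p; cases u; cases v) auto

lemma C1_prefix_closed:
  assumes "C1 \<Omega>" and "u @ v \<in> \<Omega>"
  shows "u \<in> \<Omega>"
  using assms(2)
proof (induction v rule: rev_induct)
  case (snoc b v)
  then have "butlast (u @ v @ [b]) \<in> \<Omega>"
    using assms(1) unfolding C1_def by blast
  then show ?case
    using snoc.IH by (simp add: butlast_append)
qed simp

lemma idxs_prefix_closed:
  assumes "C1 \<Omega>" and "app p u \<in> idxs \<Omega>"
  shows "p \<in> idxs \<Omega>"
  using assms by (cases p; cases u) (auto simp: idxs_def dest: C1_prefix_closed)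

text \<open>
  The convention \<open>*1 = \<eta>\<close> makes the first index another iterated concatenation, so that
  it needs no case distinction.
\<close>

lemma sigma_1: "sigma s (Suc 0) = app Star (replicate (s 1) True)"
  by (cases "s 1") auto

lemma sigma_Suc_odd:
  assumes "odd n"
  shows "sigma s (Suc n) = app (app (sigma s n) [True]) (replicate (s (Suc n)) False)"
  using assms by (cases n) (auto simp: app_append)

lemma sigma_Suc_even:
  assumes "even n" and "0 < n"
  shows "sigma s (Suc n) = app (app (sigma s n) [False]) (replicate (s (Suc n)) True)"
  using assms by (cases n) (auto simp: app_append)

lemma sigma_Suc_odd_not_Star: "odd n \<Longrightarrow> sigma s (Suc n) \<noteq> Star"
  by (cases "sigma s n") (simp_all add: sigma_Suc_odd)

section \<open>Neighbours of a common vertex\<close>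

text \<open>With \<open>*0 = *1 = \<eta>\<close>, the equation for the null sequence becomes an instance of both others.\<close>

lemma adj_eqs_app_False:
  assumes "adj_eqs \<Omega> l r" and "app p [False] \<in> idxs \<Omega>"
  shows "l (app p [False]) + r (app p [False]) = r Star * l p"
  using assms by (cases p) (auto simp: adj_eqs_def idxs_def)

lemma adj_eqs_app_True:
  assumes "adj_eqs \<Omega> l r" and "app p [True] \<in> idxs \<Omega>"
  shows "l (app p [True]) + r (app p [True]) = l Star * r p"
  using assms by (cases p) (auto simp: adj_eqs_def idxs_def)

lemma adj_eqs_diff_app_True:
  assumes "C1 \<Omega>" and "adj_eqs \<Omega> l r" and "adj_eqs \<Omega> l r'"
    and "app p (replicate k True) \<in> idxs \<Omega>"
  shows "r' (app p (replicate k True)) - r (app p (replicate k True)) =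
    l Star ^ k * (r' p - r p)"
  using assms(4)
proof (induction k)
  case 0
  then show ?case by (cases p) auto
next
  case (Suc k)
  let ?p = "app p (replicate k True)"
  have step: "app p (replicate (Suc k) True) = app ?p [True]"
    by (simp add: app_append replicate_append_same)
  have mem: "app ?p [True] \<in> idxs \<Omega>"
    using Suc.prems by (simp only: step)
  have IH: "r' ?p - r ?p = l Star ^ k * (r' p - r p)"
    using Suc.IH idxs_prefix_closed[OF assms(1) mem] by blast
  have "r' (app ?p [True]) - r (app ?p [True]) = l Star * (r' ?p - r ?p)"
    unfolding right_diff_distrib
      adj_eqs_app_True[OF assms(2) mem, symmetric] adj_eqs_app_True[OF assms(3) mem, symmetric]
    by simp
  then show ?case
    unfolding step IH by simp
qed

lemma adj_eqs_diff_app_False: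
  assumes "C1 \<Omega>" and "adj_eqs \<Omega> l r" and "adj_eqs \<Omega> l' r"
    and "app p (replicate k False) \<in> idxs \<Omega>"
  shows "l' (app p (replicate k False)) - l (app p (replicate k False)) =
    r Star ^ k * (l' p - l p)"
  using assms(4)
proof (induction k)
  case 0
  then show ?case by (cases p) auto
next
  case (Suc k)
  let ?p = "app p (replicate k False)"
  have step: "app p (replicate (Suc k) False) = app ?p [False]"
    by (simp add: app_append replicate_append_same)
  have mem: "app ?p [False] \<in> idxs \<Omega>"
    using Suc.prems by (simp only: step)
  have IH: "l' ?p - l ?p = r Star ^ k * (l' p - l p)"
    using Suc.IH idxs_prefix_closed[OF assms(1) mem] by blast
  have "l' (app ?p [False]) - l (app ?p [False]) = r Star * (l' ?p - l ?p)"
    unfolding right_diff_distrib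
      adj_eqs_app_False[OF assms(2) mem, symmetric] adj_eqs_app_False[OF assms(3) mem, symmetric]
    by simp
  then show ?case
    unfolding step IH by simp
qed

text \<open>
  Every \<open>1\<close> of the block contributes one color of the common vertex; the \<open>0\<close> in front of them
  brings in the entry of the common vertex itself, which cancels from the left-hand sides of the
  two equations at \<open>p0\<close> but not from the right-hand sides.
\<close>

lemma adj_eqs_diff_R:
  assumes "C1 \<Omega>" and "adj_eqs \<Omega> l r" and "adj_eqs \<Omega> l r'"
    and mem: "app (app p [False]) (replicate k True) \<in> idxs \<Omega>"
  shows "r' (app (app p [False]) (replicate k True)) - r (app (app p [False]) (replicate k True)) =
    l p * ((r' Star - r Star) * l Star ^ k)"
proof -
  have p: "app p [False] \<in> idxs \<Omega>"
    using idxs_prefix_closed[OF assms(1) mem] .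
  have "r' (app p [False]) - r (app p [False]) = (r' Star - r Star) * l p"
    unfolding left_diff_distrib
      adj_eqs_app_False[OF assms(2) p, symmetric] adj_eqs_app_False[OF assms(3) p, symmetric]
    by simp
  then show ?thesis
    using adj_eqs_diff_app_True[OF assms] by (simp add: mult_ac)
qed

lemma adj_eqs_diff_L:
  assumes "C1 \<Omega>" and "adj_eqs \<Omega> l r" and "adj_eqs \<Omega> l' r"
    and mem: "app (app p [True]) (replicate k False) \<in> idxs \<Omega>"
  shows "l' (app (app p [True]) (replicate k False)) - l (app (app p [True]) (replicate k False)) =
    r p * ((l' Star - l Star) * r Star ^ k)"
proof -
  have p: "app p [True] \<in> idxs \<Omega>"
    using idxs_prefix_closed[OF assms(1) mem] .
  have "l' (app p [True]) - l (app p [True]) = (l' Star - l Star) * r p"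
    unfolding left_diff_distrib
      adj_eqs_app_True[OF assms(2) p, symmetric] adj_eqs_app_True[OF assms(3) p, symmetric]
    by simp
  then show ?thesis
    using adj_eqs_diff_app_False[OF assms] by (simp add: mult_ac)
qed

section \<open>Sums over interlacing tuples\<close>

definition Phi_sum :: "(nat \<Rightarrow> 'a::field) \<Rightarrow> (nat \<Rightarrow> nat) \<Rightarrow> nat \<Rightarrow> nat \<Rightarrow> 'a" where
  "Phi_sum x s n i = (\<Sum>a\<in>tuples n i. Phi x s a n)"

definition Phi_factor :: "(nat \<Rightarrow> 'a::field) \<Rightarrow> (nat \<Rightarrow> nat) \<Rightarrow> nat \<Rightarrow> nat \<Rightarrow> 'a" where
  "Phi_factor x s n k =
     (if even n then (x (2 * k + 1) - x (2 * k - 1)) * x (2 * k) ^ s n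
      else (x (2 * k) - x (2 * k - 2)) * x (2 * k - 1) ^ s n)"

lemma Phi_Suc: "Phi x s a (Suc n) = Phi x s a n * Phi_factor x s (Suc n) (a (Suc n))"
  by (simp add: Phi_factor_def Let_def)

lemma Phi_cong: "(\<And>k. k \<in> {1..n} \<Longrightarrow> a k = b k) \<Longrightarrow> Phi x s a n = Phi x s b n"
proof (induction n)
  case (Suc n)
  from Suc.prems have "a (Suc n) = b (Suc n)" by simp
  moreover have "Phi x s a n = Phi x s b n" by (rule Suc.IH) (simp add: Suc.prems)
  ultimately show ?case by (simp only: Phi_Suc)
qed simp

lemma finite_tuples: "finite (tuples n i)"
  unfolding tuples_def by (rule finite_subset[of _ "{1..n} \<rightarrow>\<^sub>E {1..i}"]) (auto intro: finite_PiE)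

lemma Phi_sum_0: "Phi_sum x s 0 i = 1"
proof -
  have "tuples 0 i = {\<lambda>_. undefined}"
    by (auto simp: tuples_def)
  then show ?thesis by (simp add: Phi_sum_def)
qed

lemma tuplesD:
  assumes "a \<in> tuples n i"
  shows "k \<in> {1..n} \<Longrightarrow> 1 \<le> a k \<and> a k \<le> i"
    and "k \<notin> {1..n} \<Longrightarrow> a k = undefined"
    and "1 \<le> k \<Longrightarrow> k < n \<Longrightarrow> if odd k then a k \<le> a (Suc k) else a k < a (Suc k)"
  using assms by (auto simp: tuples_def PiE_iff extensional_def)

lemma tuplesI:
  assumes "\<And>k. k \<in> {1..n} \<Longrightarrow> 1 \<le> a k \<and> a k \<le> i"
    and "\<And>k. k \<notin> {1..n} \<Longrightarrow> a k = undefined"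
    and "\<And>k. 1 \<le> k \<Longrightarrow> k < n \<Longrightarrow> if odd k then a k \<le> a (Suc k) else a k < a (Suc k)"
  shows "a \<in> tuples n i"
  using assms by (auto simp: tuples_def PiE_iff extensional_def)

lemma Phi_sum_Suc_0: "Phi_sum x s (Suc n) 0 = 0"
proof -
  have "tuples (Suc n) 0 = {}"
    using tuplesD(1)[of _ "Suc n" 0 1] by fastforce
  then show ?thesis by (simp add: Phi_sum_def)
qed

lemma tuples_nondecreasing:
  assumes "a \<in> tuples n i" and "1 \<le> k" and "k \<le> m" and "m \<le> n"
  shows "a k \<le> a m"
  using assms(3)
proof (induction rule: inc_induct)
  case (step m')
  with assms(2,4) have "1 \<le> m'" "m' < n" by simp_all
  then have "a m' \<le> a (Suc m')"
    using tuplesD(3)[OF assms(1), of m'] by (auto split: if_splits)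
  then show ?case using step.IH by simp
qed simp

text \<open>
  Components are nondecreasing, so a last component of at most \<open>i\<close> bounds all others by \<open>i\<close>.
  Otherwise the last component is \<open>Suc i\<close>, and the preceding ones form a shorter tuple, bounded
  by \<open>Suc i\<close> or by \<open>i\<close> according to whether \<open>\<le>\<close> or \<open><\<close> links the last two components.
\<close>

lemma tuples_Suc_Suc:
  "tuples (Suc n) (Suc i) =
    tuples (Suc n) i \<union> (\<lambda>a. a(Suc n := Suc i)) ` tuples n (if odd n then Suc i else i)"
    (is "?A = ?B \<union> ?g ` tuples n ?m")
proof (intro equalityI subsetI)
  fix a assume a: "a \<in> ?A"
  show "a \<in> ?B \<union> ?g ` tuples n ?m"
  proof (cases "a (Suc n) = Suc i")
    case False
    then have *: "a (Suc n) \<le> i"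
      using tuplesD(1)[OF a, of "Suc n"] by simp
    have "1 \<le> a k \<and> a k \<le> i" if "k \<in> {1..Suc n}" for k
      using tuplesD(1)[OF a that] tuples_nondecreasing[OF a, of k "Suc n"] that * by simp
    then have "a \<in> ?B"
      using tuplesD(2,3)[OF a] by (rule tuplesI)
    then show ?thesis ..
  next
    case True
    let ?b = "a(Suc n := undefined)"
    have last: "a k \<le> ?m" if "k \<in> {1..n}" for k
    proof -
      have "1 \<le> n" using that by simp
      then have *: "a n \<le> ?m"
        using tuplesD(3)[OF a, of n] True by (auto split: if_splits)
      show ?thesis
      proof (cases "odd n")
        case odd: True
        then show ?thesis using tuplesD(1)[OF a, of k] that by simp
      next
        case False
        \<comment> \<open>the strict bound on the last component passes to the earlier ones\<close>
        have "a k \<le> a n"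
          using tuples_nondecreasing[OF a, of k n] that by simp
        then show ?thesis using * by simp
      qed
    qed
    have "?b \<in> tuples n ?m"
    proof (rule tuplesI)
      fix k assume "k \<in> {1..n}"
      then show "1 \<le> ?b k \<and> ?b k \<le> ?m"
        using last[of k] tuplesD(1)[OF a, of k] by simp
    next
      fix k assume "k \<notin> {1..n}"
      then show "?b k = undefined"
        using tuplesD(2)[OF a, of k] by auto
    next
      fix k assume "1 \<le> k" "k < n"
      then show "if odd k then ?b k \<le> ?b (Suc k) else ?b k < ?b (Suc k)"
        using tuplesD(3)[OF a, of k] by simp
    qed
    moreover have "a = ?g ?b"
      using True by (simp add: fun_eq_iff)
    ultimately show ?thesis by blast
  qed
next
  fix a assume "a \<in> ?B \<union> ?g ` tuples n ?m"
  then show "a \<in> ?A"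
  proof
    assume a: "a \<in> ?B"
    have "1 \<le> a k \<and> a k \<le> Suc i" if "k \<in> {1..Suc n}" for k
      using tuplesD(1)[OF a that] by simp
    then show ?thesis
      using tuplesD(2,3)[OF a] by (rule tuplesI)
  next
    assume "a \<in> ?g ` tuples n ?m"
    then obtain b where b: "b \<in> tuples n ?m" and a: "a = ?g b" by blast
    show ?thesis
    proof (rule tuplesI)
      fix k assume "k \<in> {1..Suc n}"
      then show "1 \<le> a k \<and> a k \<le> Suc i"
        using tuplesD(1)[OF b, of k] by (cases "k = Suc n") (auto simp: a split: if_splits)
    next
      fix k assume "k \<notin> {1..Suc n}"
      then show "a k = undefined"
        using tuplesD(2)[OF b, of k] by (auto simp: a)
    next
      fix k assume k: "1 \<le> k" "k < Suc n"
      show "if odd k then a k \<le> a (Suc k) else a k < a (Suc k)"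
      proof (cases "k = n")
        case True
        then show ?thesis
          using tuplesD(1)[OF b, of n] k by (auto simp: a)
      next
        case False
        then show ?thesis
          using tuplesD(3)[OF b, of k] k by (simp add: a)
      qed
    qed
  qed
qed

lemma Phi_sum_Suc:
  "Phi_sum x s (Suc n) (Suc i) = Phi_sum x s (Suc n) i +
     Phi_sum x s n (if odd n then Suc i else i) * Phi_factor x s (Suc n) (Suc i)"
proof -
  let ?T = "tuples n (if odd n then Suc i else i)"
  let ?g = "\<lambda>a :: nat \<Rightarrow> nat. a(Suc n := Suc i)"
  have "?g a \<notin> tuples (Suc n) i" for a
    using tuplesD(1)[of "?g a" "Suc n" i "Suc n"] by auto
  then have disj: "tuples (Suc n) i \<inter> ?g ` ?T = {}"
    by blast
  have inj: "inj_on ?g ?T"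
  proof (rule inj_onI)
    fix a b assume ab: "a \<in> ?T" "b \<in> ?T" "?g a = ?g b"
    have "a (Suc n) = b (Suc n)"
      using tuplesD(2)[OF ab(1), of "Suc n"] tuplesD(2)[OF ab(2), of "Suc n"] by simp
    with ab(3) show "a = b"
      by (metis fun_upd_triv fun_upd_upd)
  qed
  have "Phi x s (?g a) (Suc n) = Phi x s a n * Phi_factor x s (Suc n) (Suc i)" for a
    using Phi_cong[of n "?g a" a x s] by (simp add: Phi_Suc del: Phi.simps)
  then have "(\<Sum>a\<in>?g ` ?T. Phi x s a (Suc n)) =
      (\<Sum>a\<in>?T. Phi x s a n * Phi_factor x s (Suc n) (Suc i))"
    by (simp add: sum.reindex[OF inj] del: Phi.simps)
  then show ?thesis
    unfolding Phi_sum_def tuples_Suc_Suc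
    by (subst sum.union_disjoint[OF finite_tuples finite_imageI[OF finite_tuples] disj])
      (simp add: sum_distrib_right)
qed

section \<open>Entries along a walk\<close>

text \<open>
  The vertices \<open>R 0, L 0, R 1, L 1, \<dots>\<close> are numbered \<open>0, 1, 2, 3, \<dots>\<close>.  When \<open>s 1 = 0\<close>, the index
  \<open>sigma s 1\<close> is \<open>Star\<close>, and the induction on \<open>n\<close> needs the formula for this color as well: this
  is why \<open>mem\<close> refers to \<open>idxs \<Omega>\<close> and not to \<open>\<Omega>\<close>.
\<close>

lemma walk_entries:
  fixes L R :: "nat \<Rightarrow> idx \<Rightarrow> 'a::field"
  assumes C1: "C1 \<Omega>"
    and LR: "\<And>i. enat (2 * i + 1) \<le> N \<Longrightarrow> adj_eqs \<Omega> (L i) (R i)"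
    and RL: "\<And>i. enat (2 * i + 2) \<le> N \<Longrightarrow> adj_eqs \<Omega> (L i) (R (Suc i))"
    and xL: "\<And>i. x (2 * i + 1) = L i Star"
    and xR: "\<And>i. x (2 * i) = R i Star"
    and R0: "R 0 = (\<lambda>_. 0)"
    and L0: "\<And>w. w \<in> \<Omega> \<Longrightarrow> L 0 (Word w) = 0"
    and mem: "sigma s (Suc n) \<in> idxs \<Omega>"
  shows "even n \<Longrightarrow> enat (2 * i) \<le> N \<Longrightarrow> R i (sigma s (Suc n)) = Phi_sum x s (Suc n) i"
    and "odd n \<Longrightarrow> enat (2 * i + 1) \<le> N \<Longrightarrow> L i (sigma s (Suc n)) = Phi_sum x s (Suc n) i"
proof -
  have down: "enat m \<le> N" if "enat k \<le> N" "m \<le> k" for m k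
    using that by (meson enat_ord_simps(1) order_trans)
  have xs: "x (2 * Suc i) = R (Suc i) Star" "x (2 * Suc i - 2) = R i Star"
    "x (2 * Suc i - 1) = L i Star" "x (2 * Suc i + 1) = L (Suc i) Star" for i
    using xR[of "Suc i"] xR[of i] xL[of i] xL[of "Suc i"] by simp_all
  have "(even n \<longrightarrow> (\<forall>i. enat (2 * i) \<le> N \<longrightarrow> R i (sigma s (Suc n)) = Phi_sum x s (Suc n) i)) \<and>
    (odd n \<longrightarrow> (\<forall>i. enat (2 * i + 1) \<le> N \<longrightarrow> L i (sigma s (Suc n)) = Phi_sum x s (Suc n) i))"
    using mem
  proof (induction n)
    case 0
    have mem: "app Star (replicate (s 1) True) \<in> idxs \<Omega>"
      using "0.prems" unfolding sigma_1 .
    have "R i (sigma s (Suc 0)) = Phi_sum x s (Suc 0) i" if "enat (2 * i) \<le> N" for i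
      using that
    proof (induction i)
      case 0
      then show ?case by (simp only: R0 Phi_sum_Suc_0)
    next
      case (Suc i)
      have "R (Suc i) (sigma s (Suc 0)) - R i (sigma s (Suc 0)) =
          L i Star ^ s 1 * (R (Suc i) Star - R i Star)"
        unfolding sigma_1 using mem Suc.prems
        by (intro adj_eqs_diff_app_True[OF C1] LR RL) (auto elim: down)
      also have "\<dots> = Phi_factor x s (Suc 0) (Suc i)"
        by (simp only: Phi_factor_def xs even_Suc) simp
      finally show ?case
        using Suc.IH down[OF Suc.prems, of "2 * i"]
        by (simp add: Phi_sum_Suc Phi_sum_0 diff_eq_eq add.commute del: sigma.simps)
    qed
    then show ?case by simp
  next
    case (Suc n)
    let ?p = "sigma s (Suc n)"
    show ?case
    proof (cases "even n")
      case True
      have sigma: "sigma s (Suc (Suc n)) = app (app ?p [True]) (replicate (s (Suc (Suc n))) False)"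
        using True by (intro sigma_Suc_odd) simp
      have mem: "app (app ?p [True]) (replicate (s (Suc (Suc n))) False) \<in> idxs \<Omega>"
        using Suc.prems unfolding sigma .
      then have "?p \<in> idxs \<Omega>"
        using idxs_prefix_closed[OF C1] by blast
      then have IH: "R i ?p = Phi_sum x s (Suc n) i" if "enat (2 * i) \<le> N" for i
        using Suc.IH True that by blast
      have "L i (sigma s (Suc (Suc n))) = Phi_sum x s (Suc (Suc n)) i"
        if "enat (2 * i + 1) \<le> N" for i
        using that
      proof (induction i)
        case 0
        have "sigma s (Suc (Suc n)) \<noteq> Star"
          using True by (intro sigma_Suc_odd_not_Star) simp
        then show ?case
          using L0 Suc.prems by (auto simp: idxs_def Phi_sum_Suc_0 simp del: sigma.simps)
      next
        case (Suc i)
        have "L (Suc i) (sigma s (Suc (Suc n))) - L i (sigma s (Suc (Suc n))) =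
            R (Suc i) ?p * ((L (Suc i) Star - L i Star) * R (Suc i) Star ^ s (Suc (Suc n)))"
          unfolding sigma using Suc.prems mem
          by (intro adj_eqs_diff_L[OF C1] LR RL) (auto simp del: sigma.simps elim: down)
        also have "\<dots> = Phi_sum x s (Suc n) (Suc i) * Phi_factor x s (Suc (Suc n)) (Suc i)"
          using True IH[OF down[OF Suc.prems, of "2 * Suc i"]]
          by (simp add: Phi_factor_def xs[simplified] del: sigma.simps)
        finally show ?case
          using Suc.IH down[OF Suc.prems, of "2 * i + 1"] True
          by (simp add: Phi_sum_Suc[of _ _ "Suc n"] diff_eq_eq add.commute del: sigma.simps)
      qed
      then show ?thesis using True by simp
    next
      case False
      have sigma: "sigma s (Suc (Suc n)) = app (app ?p [False]) (replicate (s (Suc (Suc n))) True)"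
        using False by (intro sigma_Suc_even) simp_all
      have mem: "app (app ?p [False]) (replicate (s (Suc (Suc n))) True) \<in> idxs \<Omega>"
        using Suc.prems unfolding sigma .
      then have "?p \<in> idxs \<Omega>"
        using idxs_prefix_closed[OF C1] by blast
      then have IH: "L i ?p = Phi_sum x s (Suc n) i" if "enat (2 * i + 1) \<le> N" for i
        using Suc.IH False that by blast
      have "R i (sigma s (Suc (Suc n))) = Phi_sum x s (Suc (Suc n)) i"
        if "enat (2 * i) \<le> N" for i
        using that
      proof (induction i)
        case 0
        then show ?case by (simp only: R0 Phi_sum_Suc_0)
      next
        case (Suc i)
        have "R (Suc i) (sigma s (Suc (Suc n))) - R i (sigma s (Suc (Suc n))) =
            L i ?p * ((R (Suc i) Star - R i Star) * L i Star ^ s (Suc (Suc n)))"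
          unfolding sigma using Suc.prems mem
          by (intro adj_eqs_diff_R[OF C1] LR RL) (auto simp del: sigma.simps elim: down)
        also have "\<dots> = Phi_sum x s (Suc n) i * Phi_factor x s (Suc (Suc n)) (Suc i)"
          using False IH[OF down[OF Suc.prems, of "2 * i + 1"]]
          by (simp add: Phi_factor_def xs[simplified] del: sigma.simps)
        finally show ?case
          using Suc.IH down[OF Suc.prems, of "2 * i"] False
          by (simp add: Phi_sum_Suc[of _ _ "Suc n"] diff_eq_eq add.commute del: sigma.simps)
      qed
      then show ?thesis using False by simp
    qed
  qed
  then show "even n \<Longrightarrow> enat (2 * i) \<le> N \<Longrightarrow> R i (sigma s (Suc n)) = Phi_sum x s (Suc n) i"
    and "odd n \<Longrightarrow> enat (2 * i + 1) \<le> N \<Longrightarrow> L i (sigma s (Suc n)) = Phi_sum x s (Suc n) i"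
    by blast+
qed

theorem theorem7:
  fixes \<Omega> :: "word set"
    and l r :: "nat \<Rightarrow> idx \<Rightarrow> 'a::{field,finite}"
    and x :: "nat \<Rightarrow> 'a"
    and N :: enat
    and s :: "nat \<Rightarrow> nat"
    and i j :: nat
  assumes "finite \<Omega>"
    and "C1 \<Omega>"
    and "is_path \<Omega> N (\<lambda>k. if odd k then LV (l k) else RV (r k))"
    and "x = colors l r"
    and "l 1 = zero_vec \<Omega> (x 1)"
    and "1 \<le> j"
    and "j \<le> i"
  shows "(enat (2 * i) \<le> N \<and> sigma s (2 * j - 1) \<in> Word ` \<Omega> \<longrightarrow>
            r (2 * i) (sigma s (2 * j - 1)) = (\<Sum>a\<in>tuples (2 * j - 1) i. Phi x s a (2 * j - 1))) \<and>
         (enat (2 * i + 1) \<le> N \<and> sigma s (2 * j) \<in> Word ` \<Omega> \<longrightarrow>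
            l (2 * i + 1) (sigma s (2 * j)) = (\<Sum>a\<in>tuples (2 * j) i. Phi x s a (2 * j)))"
proof -
  let ?v = "\<lambda>k. if odd k then LV (l k) else RV (r k)"
  \<comment> \<open>the zero vector takes the place of \<open>r 0\<close>, which is not on the path\<close>
  define R where "R i = (if i = 0 then (\<lambda>_. 0) else r (2 * i))" for i
  define L where "L i = l (2 * i + 1)" for i
  have adj: "adj \<Omega> (?v k) (?v (k + 1))" if "1 \<le> k" "enat (k + 1) \<le> N" for k
    using assms(3) that unfolding is_path_def by blast
  have L0: "L 0 (Word w) = 0" if "w \<in> \<Omega>" for w
    using that assms(5) by (simp add: L_def zero_vec_def idxs_def)
  have LR: "adj_eqs \<Omega> (L i) (R i)" if "enat (2 * i + 1) \<le> N" for i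
  proof (cases "i = 0")
    case True
    have "[] \<in> \<Omega>"
      using assms(2) by (simp add: C1_def)
    moreover have "\<alpha> \<in> \<Omega>" if "\<alpha> @ [b] \<in> \<Omega>" for \<alpha> b
      using C1_prefix_closed[OF assms(2) that] .
    ultimately show ?thesis
      using True L0 by (simp add: adj_eqs_def R_def)
  next
    case False
    then show ?thesis
      using adj[of "2 * i"] that by (simp add: L_def R_def)
  qed
  have RL: "adj_eqs \<Omega> (L i) (R (Suc i))" if "enat (2 * i + 2) \<le> N" for i
    using adj[of "2 * i + 1"] that by (simp add: L_def R_def)
  have xL: "x (2 * i + 1) = L i Star" and xR: "x (2 * i) = R i Star" for i
    using assms(4) by (simp_all add: colors_def L_def R_def)
  have R0: "R 0 = (\<lambda>_. 0)" by (simp add: R_def)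
  note entries = walk_entries[of \<Omega> N L R x, OF assms(2) LR RL xL xR R0 L0]
  have idx: "k \<in> Word ` \<Omega> \<Longrightarrow> k \<in> idxs \<Omega>" for k
    by (simp add: idxs_def)
  obtain m where m: "j = Suc m"
    using assms(6) by (cases j) auto
  have n: "2 * j - 1 = Suc (2 * m)" "2 * j = Suc (2 * m + 1)"
    using m by simp_all
  have "R i = r (2 * i)" and "L i = l (2 * i + 1)"
    using assms(6,7) by (auto simp: R_def L_def)
  then show ?thesis
    using entries(1)[of s "2 * m" i] entries(2)[of s "2 * m + 1" i] idx
    unfolding n Phi_sum_def by (auto simp del: sigma.simps Phi.simps)
qed

end
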